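(* Let $\mathcal{T}$ be the binary tetrahedral group and $\mathcal{I}$ the binary icosahedral group. Then (1) $\mu(\mathcal{T}\times\mathcal{T})=16$, and (2) $\mu(\mathcal{I}\times\mathcal{I})=48$.
   Context: For a finite group $G$, $\mu(G)$ denotes the minimal faithful permutation degree of $G$: the least non-negative integer $m$ such that $G$ embeds in $\mathrm{Sym}(m)$. In the real quaternions $\mathbb{H}$, let $Q_8=\{\pm1,\pm i,\pm j,\pm k\}$, $\omega=\frac12(-1+i+j+k)$, $\tau=\frac12(1+\sqrt5)$ and $\sigma=\frac12(\tau^{-1}+i+\tau j)$. The binary tetrahedral group is $\mathcal{T}=Q_8\langle\omega\rangle$, of order $24$; the binary icosahedral group $\mathcal{I}=\mathcal{T}\langle\sigma\rangle$ is the group generated by $\mathcal{T}$ and $\sigma$, of order $120$. *)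

theory Defs
  imports Complex_Main "HOL-Algebra.Sym_Groups"
begin

section \<open>Real quaternions\<close>

codatatype quat = Quat (Re0: real) (Im1: real) (Im2: real) (Im3: real)

lemma quat_eq_iff:
  "x = y \<longleftrightarrow> Re0 x = Re0 y \<and> Im1 x = Im1 y \<and> Im2 x = Im2 y \<and> Im3 x = Im3 y"
  by (auto intro: quat.expand)

instantiation quat :: real_vector
begin

primcorec zero_quat where
  "Re0 0 = 0" | "Im1 0 = 0" | "Im2 0 = 0" | "Im3 0 = 0"

primcorec plus_quat where
  "Re0 (x + y) = Re0 x + Re0 y"
| "Im1 (x + y) = Im1 x + Im1 y"
| "Im2 (x + y) = Im2 x + Im2 y"
| "Im3 (x + y) = Im3 x + Im3 y"

primcorec uminus_quat where
  "Re0 (- x) = - Re0 x" | "Im1 (- x) = - Im1 x" | "Im2 (- x) = - Im2 x" | "Im3 (- x) = - Im3 x"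

primcorec minus_quat where
  "Re0 (x - y) = Re0 x - Re0 y"
| "Im1 (x - y) = Im1 x - Im1 y"
| "Im2 (x - y) = Im2 x - Im2 y"
| "Im3 (x - y) = Im3 x - Im3 y"

primcorec scaleR_quat where
  "Re0 (scaleR r x) = r * Re0 x"
| "Im1 (scaleR r x) = r * Im1 x"
| "Im2 (scaleR r x) = r * Im2 x"
| "Im3 (scaleR r x) = r * Im3 x"

instance
  by standard (auto simp: quat_eq_iff algebra_simps)

end

instantiation quat :: real_div_algebra
begin

primcorec one_quat where
  "Re0 1 = 1" | "Im1 1 = 0" | "Im2 1 = 0" | "Im3 1 = 0"

primcorec times_quat where
  "Re0 (x * y) = Re0 x * Re0 y - Im1 x * Im1 y - Im2 x * Im2 y - Im3 x * Im3 y"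
| "Im1 (x * y) = Re0 x * Im1 y + Im1 x * Re0 y + Im2 x * Im3 y - Im3 x * Im2 y"
| "Im2 (x * y) = Re0 x * Im2 y - Im1 x * Im3 y + Im2 x * Re0 y + Im3 x * Im1 y"
| "Im3 (x * y) = Re0 x * Im3 y + Im1 x * Im2 y - Im2 x * Im1 y + Im3 x * Re0 y"

primcorec inverse_quat where
  "Re0 (inverse x) = Re0 x / ((Re0 x)\<^sup>2 + (Im1 x)\<^sup>2 + (Im2 x)\<^sup>2 + (Im3 x)\<^sup>2)"
| "Im1 (inverse x) = - Im1 x / ((Re0 x)\<^sup>2 + (Im1 x)\<^sup>2 + (Im2 x)\<^sup>2 + (Im3 x)\<^sup>2)"
| "Im2 (inverse x) = - Im2 x / ((Re0 x)\<^sup>2 + (Im1 x)\<^sup>2 + (Im2 x)\<^sup>2 + (Im3 x)\<^sup>2)"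
| "Im3 (inverse x) = - Im3 x / ((Re0 x)\<^sup>2 + (Im1 x)\<^sup>2 + (Im2 x)\<^sup>2 + (Im3 x)\<^sup>2)"

definition "x div y = x * inverse y" for x y :: quat

instance
proof
  fix x y :: quat
  show "inverse x * x = 1" "x * inverse x = 1" if "x \<noteq> 0"
  proof -
    let ?n = "(Re0 x)\<^sup>2 + (Im1 x)\<^sup>2 + (Im2 x)\<^sup>2 + (Im3 x)\<^sup>2"
    have "?n \<noteq> 0"
      using that by (auto simp: quat_eq_iff add_nonneg_eq_0_iff)
    then have "Re0 x * Re0 x / ?n + Im1 x * Im1 x / ?n + Im2 x * Im2 x / ?n + Im3 x * Im3 x / ?n = 1"
      by (simp add: power2_eq_square flip: add_divide_distrib)
    then show "inverse x * x = 1" "x * inverse x = 1"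
      by (simp_all add: quat_eq_iff mult.commute)
  qed
qed (auto simp: quat_eq_iff divide_quat_def algebra_simps)

end

definition quat_i :: quat where "quat_i = Quat 0 1 0 0"
definition quat_j :: quat where "quat_j = Quat 0 0 1 0"
definition quat_k :: quat where "quat_k = Quat 0 0 0 1"

lemma quat_units_relations:
  "quat_i * quat_i = -1" "quat_j * quat_j = -1" "quat_k * quat_k = -1"
  "quat_i * quat_j = quat_k" "quat_j * quat_k = quat_i" "quat_k * quat_i = quat_j"
  by (simp_all add: quat_eq_iff quat_i_def quat_j_def quat_k_def)

definition quat_units :: "quat monoid" where
  "quat_units = \<lparr>carrier = {q. q \<noteq> 0}, mult = (*), one = 1\<rparr>"

lemma group_quat_units: "group quat_units"
proof (rule groupI)
  fix x assume "x \<in> carrier quat_units"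
  then show "\<exists>y\<in>carrier quat_units. y \<otimes>\<^bsub>quat_units\<^esub> x = \<one>\<^bsub>quat_units\<^esub>"
    by (intro bexI[of _ "inverse x"]) (auto simp: quat_units_def)
qed (auto simp: quat_units_def mult.assoc)


section \<open>The binary tetrahedral and icosahedral groups\<close>

definition Q8 :: "quat set" where
  "Q8 = {1, -1, quat_i, - quat_i, quat_j, - quat_j, quat_k, - quat_k}"

definition omega :: quat where
  "omega = (1/2) *\<^sub>R (- 1 + quat_i + quat_j + quat_k)"

definition tau :: real where
  "tau = (1 + sqrt 5) / 2"

definition sigma :: quat where
  "sigma = (1/2) *\<^sub>R (of_real (inverse tau) + quat_i + tau *\<^sub>R quat_j)"

text \<open>The carrier is the product set of the quaternion group and the cyclic group generated
  by \<open>omega\<close>.\<close>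

definition binary_tetrahedral :: "quat monoid" where
  "binary_tetrahedral =
     quat_units\<lparr>carrier := Q8 <#>\<^bsub>quat_units\<^esub> generate quat_units {omega}\<rparr>"

definition binary_icosahedral :: "quat monoid" where
  "binary_icosahedral =
     quat_units\<lparr>carrier := generate quat_units (carrier binary_tetrahedral \<union> {sigma})\<rparr>"


section \<open>Minimal faithful permutation degree\<close>

text \<open>Intended for finite groups; \<open>LEAST\<close> is unspecified if \<open>G\<close> embeds in no finite
  symmetric group.\<close>

definition min_perm_degree :: "('a, 'b) monoid_scheme \<Rightarrow> nat" where
  "min_perm_degree G = (LEAST m. mon G (sym_group m) \<noteq> {})"

end

theory Submission
  imports Defs "HOL-Algebra.Sylow" "HOL-Algebra.Group_Action" "HOL-Algebra.Multiplicative_Group"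
begin

text \<open>Let \<open>K\<close> be one of the two groups.  In the quaternions \<open>x * x = 1\<close> has only the solutions \<open>1\<close> and \<open>- 1\<close>, so
  \<open>- 1\<close> is the unique involution of \<open>K\<close>.  Let \<open>m\<close> be the largest order of a subgroup of odd order: 3 for
  the tetrahedral and 5 for the icosahedral group.  The degree of \<open>K \<times>\<times> K\<close> is then \<open>2 * (order K div m)\<close>
  (\<open>min_perm_degree_square\<close>), which gives \<open>2 * 8\<close> and \<open>2 * 24\<close>.

  Upper bound (\<open>coset_embedding\<close>): a subgroup \<open>P\<close> of order \<open>m\<close>, generated by \<^const>\<open>omega\<close> or
  \<^const>\<open>sigma\<close>, contains no nontrivial normal subgroup, so each factor acts faithfully on its own copy of
  the \<open>order K div m\<close> cosets of \<open>P\<close>.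

  Lower bound (\<open>perm_degree_lower_bound\<close>): the involutions of \<open>K \<times>\<times> K\<close> are the three nontrivial pairs of
  signs, and they are central.  If one of them acts nontrivially on an orbit, a point stabiliser meets one
  of the factors in a subgroup of odd order, so the orbit has at least \<open>order K / m\<close> points.  A faithful
  action either has two such orbits, or a single one whose stabilisers have odd order and which is
  therefore even larger.

  The value of \<open>m\<close> comes from an averaging argument (\<open>odd_quat_subgroup_card_le\<close>) that replaces a
  classification of subgroups: the elements of a nontrivial finite subgroup add up to 0, and squaring permutes a
  group of odd order, so the real parts of all \<open>h\<^sup>2 + h\<^sup>4\<close> add up to 0.  The unit contributes 2,
  every other element exactly \<open>- 1\<close> in the tetrahedral and at most \<open>- 1 / 2\<close> in the icosahedral group.

  The groups are made explicit as products of \<open>Q8\<close>, the powers of \<^const>\<open>omega\<close>, and (for the icosahedral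
  group) the powers of \<^const>\<open>sigma\<close>; orders and real parts are read off from this form.\<close>

section \<open>Groups with a unique involution\<close>

text \<open>Cauchy's theorem for the prime 2: a group of even order has a subgroup of order 2, and its
  nontrivial element is an involution.\<close>

lemma (in group) odd_order_if_no_involution:
  assumes fin: "finite (carrier G)"
    and no_inv: "\<And>x. x \<in> carrier G \<Longrightarrow> x \<otimes> x = \<one> \<Longrightarrow> x = \<one>"
  shows "odd (order G)"
proof
  assume "even (order G)"
  then obtain k where "order G = 2 ^ 1 * k" by auto
  then obtain H where H: "subgroup H G" and card: "card H = 2 ^ 1"
    using sylow_thm[of 2 G 1 k] fin is_group by auto
  have one: "\<one> \<in> H" using H by (rule subgroup.one_closed)
  obtain a b where ab: "H = {a, b}" "a \<noteq> b" using card by (auto simp: card_2_iff)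
  define x where "x = (if a = \<one> then b else a)"
  have x: "x \<noteq> \<one>" "H = {\<one>, x}" using ab one by (auto simp: x_def)
  have xG: "x \<in> carrier G" using x subgroup.subset[OF H] by auto
  have "x \<otimes> x \<in> H" using subgroup.m_closed[OF H, of x x] x by simp
  moreover have "x \<otimes> x \<noteq> x" using x xG by simp
  ultimately have "x \<otimes> x = \<one>" using x by auto
  then show False using no_inv[OF xG] x(1) by simp
qed

lemma (in group) no_involution_if_odd_order:
  assumes "odd (order G)" "x \<in> carrier G" "x \<otimes> x = \<one>"
  shows "x = \<one>"
proof -
  obtain k where k: "order G = 2 * k + 1" using assms(1) by (elim oddE)
  have "x [^] order G = (x [^] (2::nat)) [^] k \<otimes> x"
    using assms(2) by (simp add: k nat_pow_pow)
  also have "x [^] (2::nat) = \<one>"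
    using assms by (simp add: numeral_2_eq_2)
  finally show ?thesis using assms(2) pow_order_eq_1 by simp
qed

lemma (in group_hom) order_eq_image_times_kernel:
  "order G = card (h ` carrier G) * card (kernel G H h)"
proof -
  let ?I = "H\<lparr>carrier := h ` carrier G\<rparr>"
  interpret I: group_hom G ?I h
    using G.is_group H.subgroup_imp_group[OF img_is_subgroup] homh
    by (auto simp: group_hom_def group_hom_axioms_def hom_def)
  have "bij_betw (\<lambda>X. the_elem (h ` X)) (carrier (G Mod kernel G ?I h)) (carrier ?I)"
    using I.FactGroup_iso_set by (simp add: iso_def)
  moreover have "kernel G ?I h = kernel G H h" by (simp add: kernel_def)
  ultimately have "bij_betw (\<lambda>X. the_elem (h ` X)) (carrier (G Mod kernel G H h)) (h ` carrier G)"
    by simp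
  then have "card (rcosets kernel G H h) = card (h ` carrier G)"
    by (simp add: bij_betw_same_card[symmetric] FactGroup_def)
  then show ?thesis using G.lagrange[OF subgroup_kernel] by simp
qed

text \<open>The situation common to both groups.  In the intended instances \<open>m\<close> is the largest order of a
  subgroup of odd order, so that \<open>order K div m\<close> is the least degree of a transitive action of \<open>K\<close>
  in which \<open>z\<close> moves a point.\<close>

locale unique_involution_group = group K for K (structure) +
  fixes z and m :: nat
  assumes finite_carrier: "finite (carrier K)"
    and z_closed: "z \<in> carrier K" and z_ne_one: "z \<noteq> \<one>" and z_square: "z \<otimes> z = \<one>"
    and involution_unique: "\<lbrakk>x \<in> carrier K; x \<otimes> x = \<one>\<rbrakk> \<Longrightarrow> x = \<one> \<or> x = z"
    and odd_bound: "\<lbrakk>subgroup H K; odd (card H)\<rbrakk> \<Longrightarrow> card H \<le> m"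
begin

lemma z_central: assumes "x \<in> carrier K" shows "x \<otimes> z = z \<otimes> x"
proof -
  let ?y = "x \<otimes> z \<otimes> inv x"
  have "?y \<otimes> ?y = x \<otimes> (z \<otimes> z) \<otimes> inv x"
    using assms z_closed by (smt (verit) inv_closed inv_solve_right l_cancel_one' m_assoc m_closed r_inv l_inv l_one)
  then have "?y \<otimes> ?y = \<one>" using z_square assms by simp
  then consider "?y = \<one>" | "?y = z"
    using involution_unique assms z_closed by (meson inv_closed m_closed)
  then show ?thesis
  proof cases
    case 1
    then have "x \<otimes> z = x" using assms z_closed inv_solve_right' by simp
    then show ?thesis using assms z_closed z_ne_one by simp
  next
    case 2
    then show ?thesis using assms z_closed inv_solve_right' by simp
  qed
qed

text \<open>This bounds point stabilisers \<open>L\<close> in \<open>K \<times>\<times> K\<close>, with the two projections as \<open>p\<close> and \<open>q\<close>.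
  By \<open>joint\<close> the kernel of \<open>q\<close> embeds into \<open>K\<close> through \<open>p\<close>; its image misses the only involution \<open>z\<close>,
  so it has odd order, hence order at most \<open>m\<close>.\<close>

lemma card_le_if_avoids:
  assumes L: "group L" "finite (carrier L)"
    and p: "p \<in> hom L K" and q: "q \<in> hom L K"
    and joint: "\<And>x. \<lbrakk>x \<in> carrier L; p x = \<one>; q x = \<one>\<rbrakk> \<Longrightarrow> x = \<one>\<^bsub>L\<^esub>"
    and avoid: "\<And>x. \<lbrakk>x \<in> carrier L; q x = \<one>\<rbrakk> \<Longrightarrow> p x \<noteq> z"
  shows "order L \<le> card (q ` carrier L) * m"
proof -
  interpret p: group_hom L K p using L p is_group by (simp add: group_hom_def group_hom_axioms_def)
  interpret q: group_hom L K q using L q is_group by (simp add: group_hom_def group_hom_axioms_def)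
  let ?N = "kernel L K q"
  have N: "subgroup ?N L" by (rule q.subgroup_kernel)
  have sub: "subgroup (p ` ?N) K" by (rule p.subgroup_img_is_subgroup[OF N])
  have "inj_on p ?N"
  proof (rule inj_onI)
    fix x y assume x: "x \<in> ?N" and y: "y \<in> ?N" and eq: "p x = p y"
    then have "x \<in> carrier L" "y \<in> carrier L" "q x = \<one>" "q y = \<one>" by (auto simp: kernel_def)
    with eq joint[of "x \<otimes>\<^bsub>L\<^esub> inv\<^bsub>L\<^esub> y"] show "x = y"
      by (simp add: L(1) group.inv_solve_right')
  qed
  then have card: "card (p ` ?N) = card ?N" by (rule card_image)
  interpret P: group "K\<lparr>carrier := p ` ?N\<rparr>" using sub by (rule subgroup_imp_group)
  have "odd (order (K\<lparr>carrier := p ` ?N\<rparr>))"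
  proof (rule P.odd_order_if_no_involution)
    show "finite (carrier (K\<lparr>carrier := p ` ?N\<rparr>))"
      using finite_subset[OF subgroup.subset[OF sub] finite_carrier] by simp
    fix y assume y: "y \<in> carrier (K\<lparr>carrier := p ` ?N\<rparr>)"
      and "y \<otimes>\<^bsub>K\<lparr>carrier := p ` ?N\<rparr>\<^esub> y = \<one>\<^bsub>K\<lparr>carrier := p ` ?N\<rparr>\<^esub>"
    then have "y = \<one> \<or> y = z" using involution_unique[of y] subgroup.subset[OF sub] by auto
    moreover have "y \<noteq> z" using y avoid by (auto simp: kernel_def)
    ultimately show "y = \<one>\<^bsub>K\<lparr>carrier := p ` ?N\<rparr>\<^esub>" by simp
  qed
  then have "card ?N \<le> m" using odd_bound[OF sub] card by (simp add: order_def)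
  then show ?thesis by (simp add: q.order_eq_image_times_kernel)
qed

end

section \<open>Permutation representations of a direct square\<close>

text \<open>Permutations of \<open>{1..d}\<close> are the identity elsewhere, whereas elements of \<^const>\<open>BijGroup\<close> are
  extensional; the restriction makes the orbit-stabiliser theorem applicable.\<close>

lemma hom_sym_group_imp_action:
  assumes "group G" "f \<in> hom G (sym_group d)"
  shows "group_action G {1..d} (\<lambda>g. restrict (f g) {1..d})"
proof -
  have perm: "f g permutes {1..d}" if "g \<in> carrier G" for g
    using assms(2) that by (auto simp: hom_def sym_group_def)
  have Bij: "restrict (f g) {1..d} \<in> Bij {1..d}" if "g \<in> carrier G" for g
    using permutes_imp_bij[OF perm[OF that]] by (simp add: Bij_def bij_betw_restrict_eq)
  show ?thesis
    unfolding group_action_def group_hom_def group_hom_axioms_def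
  proof (intro conjI assms group_BijGroup homI)
    fix g h assume gh: "g \<in> carrier G" "h \<in> carrier G"
    have "f (g \<otimes>\<^bsub>G\<^esub> h) = f g \<circ> f h"
      using assms(2) gh by (simp add: hom_def sym_group_def)
    then show "restrict (f (g \<otimes>\<^bsub>G\<^esub> h)) {1..d} =
        restrict (f g) {1..d} \<otimes>\<^bsub>BijGroup {1..d}\<^esub> restrict (f h) {1..d}"
      using Bij[OF gh(1)] Bij[OF gh(2)] permutes_in_image[OF perm[OF gh(2)]]
      by (auto simp: BijGroup_def compose_def restrict_def fun_eq_iff)
  qed (use Bij in \<open>simp add: BijGroup_def\<close>)
qed

text \<open>Faithful actions may be built on any finite set \<open>E\<close>, such as a set of cosets; a bijection
  carries them over to \<open>{1..d}\<close>.\<close>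

lemma mon_sym_group_transport:
  assumes E: "finite E" "card E = d"
    and perm: "\<And>g. g \<in> carrier G \<Longrightarrow> f g permutes E"
    and mult: "\<And>g h. \<lbrakk>g \<in> carrier G; h \<in> carrier G\<rbrakk> \<Longrightarrow> f (g \<otimes>\<^bsub>G\<^esub> h) = f g \<circ> f h"
    and inj: "inj_on f (carrier G)"
  shows "mon G (sym_group d) \<noteq> {}"
proof -
  obtain e where e: "bij_betw e E {1..d}"
    using E by (metis card_atLeastAtMost diff_Suc_1 finite_atLeastAtMost finite_same_card_bij)
  define F where "F g = (\<lambda>x. if x \<in> {1..d} then e (f g (inv_into E e x)) else x)" for g
  have inv: "inv_into E e (e x) = x" if "x \<in> E" for x
    using e that by (simp add: bij_betw_inv_into_left)
  have inE: "inv_into E e x \<in> E" if "x \<in> {1..d}" for x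
    using e that by (metis bij_betw_imp_surj_on inv_into_into)
  have eE: "e x \<in> {1..d}" if "x \<in> E" for x using e that by (auto simp: bij_betw_def)
  have fE: "f g x \<in> E" if "g \<in> carrier G" "x \<in> E" for g x
    using perm that by (simp add: permutes_in_image)
  have "F \<in> hom G (sym_group d)"
  proof (rule homI)
    fix g assume g: "g \<in> carrier G"
    show "F g \<in> carrier (sym_group d)"
      using permutes_bij_inv_into[OF perm[OF g] e] by (simp add: F_def sym_group_def)
  next
    fix g h assume gh: "g \<in> carrier G" "h \<in> carrier G"
    show "F (g \<otimes>\<^bsub>G\<^esub> h) = F g \<otimes>\<^bsub>sym_group d\<^esub> F h"
    proof
      fix x show "F (g \<otimes>\<^bsub>G\<^esub> h) x = (F g \<otimes>\<^bsub>sym_group d\<^esub> F h) x"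
        using gh inE[of x] fE[of h "inv_into E e x"] eE[of "f h (inv_into E e x)"]
        by (auto simp: F_def mult sym_group_def inv)
    qed
  qed
  moreover have "inj_on F (carrier G)"
  proof (rule inj_onI)
    fix g h assume gh: "g \<in> carrier G" "h \<in> carrier G" and eq: "F g = F h"
    have "f g = f h"
    proof
      fix x show "f g x = f h x"
      proof (cases "x \<in> E")
        case True
        have "e (f g x) = e (f h x)"
          using fun_cong[OF eq, of "e x"] True eE inv by (simp add: F_def)
        then show ?thesis using e fE gh True by (metis bij_betw_inv_into_left)
      next
        case False then show ?thesis using permutes_not_in[OF perm[OF gh(1)]] permutes_not_in[OF perm[OF gh(2)]] by simp
      qed
    qed
    then show "g = h" using inj gh by (simp add: inj_on_def)
  qed
  ultimately show ?thesis by (auto simp: mon_def)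
qed

context unique_involution_group
begin

text \<open>The three listed elements are the only involutions of \<open>K \<times>\<times> K\<close>, so \<open>H\<close> has odd order.  Both its
  projection to the second factor and the kernel of that projection then have odd order.\<close>

lemma card_le_if_no_involution:
  assumes H: "subgroup H (K \<times>\<times> K)"
    and avoid: "(z, \<one>) \<notin> H" "(\<one>, z) \<notin> H" "(z, z) \<notin> H"
  shows "card H \<le> m * m"
proof -
  interpret KK: group "K \<times>\<times> K" by (rule DirProd_group[OF is_group is_group])
  let ?L = "(K \<times>\<times> K)\<lparr>carrier := H\<rparr>"
  interpret L: group ?L using H by (rule KK.subgroup_imp_group)
  have sub: "H \<subseteq> carrier K \<times> carrier K" using subgroup.subset[OF H] by simp
  have fin: "finite H" using sub finite_carrier by (meson finite_SigmaI finite_subset)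
  have fst: "fst \<in> hom ?L K" and snd: "snd \<in> hom ?L K"
    using sub by (auto simp: hom_def mult_DirProd')
  have le: "card H \<le> card (snd ` H) * m"
    using card_le_if_avoids[OF L.is_group _ fst snd] fin avoid by (force simp: order_def)
  have "odd (order ?L)"
  proof (rule L.odd_order_if_no_involution)
    fix x assume x: "x \<in> carrier ?L" and "x \<otimes>\<^bsub>?L\<^esub> x = \<one>\<^bsub>?L\<^esub>"
    then have "fst x \<otimes> fst x = \<one>" "snd x \<otimes> snd x = \<one>" by (simp_all add: mult_DirProd')
    then have "fst x = \<one> \<or> fst x = z" "snd x = \<one> \<or> snd x = z"
      using x sub involution_unique[of "fst x"] involution_unique[of "snd x"] by auto
    then have "x \<in> {(\<one>, \<one>), (z, \<one>), (\<one>, z), (z, z)}" by (cases x) auto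
    then show "x = \<one>\<^bsub>?L\<^esub>" using x avoid by auto
  qed (simp add: fin)
  then interpret snd: group_hom ?L K snd
    using L.is_group is_group snd by (simp add: group_hom_def group_hom_axioms_def)
  have "card (snd ` H) dvd order ?L"
    using snd.order_eq_image_times_kernel by simp
  with \<open>odd (order ?L)\<close> have "odd (card (snd ` H))" by auto
  then have "card (snd ` H) \<le> m" using odd_bound snd.img_is_subgroup by simp
  then show ?thesis using le by (meson le_trans mult_le_mono1)
qed

text \<open>A stabiliser that misses one of the two central involutions meets the corresponding factor
  in a group of odd order, while its projection to the other factor has at most \<open>order K\<close> elements.\<close>

lemma card_le_if_misses_central:
  assumes H: "subgroup H (K \<times>\<times> K)" and avoid: "(z, \<one>) \<notin> H \<or> (\<one>, z) \<notin> H"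
  shows "card H \<le> order K * m"
proof -
  interpret KK: group "K \<times>\<times> K" by (rule DirProd_group[OF is_group is_group])
  let ?L = "(K \<times>\<times> K)\<lparr>carrier := H\<rparr>"
  interpret L: group ?L using H by (rule KK.subgroup_imp_group)
  have sub: "H \<subseteq> carrier K \<times> carrier K" using subgroup.subset[OF H] by simp
  have fin: "finite H" using sub finite_carrier by (meson finite_SigmaI finite_subset)
  have fst: "fst \<in> hom ?L K" and snd: "snd \<in> hom ?L K"
    using sub by (auto simp: hom_def mult_DirProd')
  have "card (snd ` H) \<le> order K" "card (fst ` H) \<le> order K"
    unfolding order_def using sub finite_carrier by (auto intro!: card_mono)
  moreover have "card H \<le> card (snd ` H) * m \<or> card H \<le> card (fst ` H) * m"
    using card_le_if_avoids[OF L.is_group _ fst snd] card_le_if_avoids[OF L.is_group _ snd fst]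
      fin avoid by (force simp: order_def)
  ultimately show ?thesis by (meson le_trans mult_le_mono1)
qed

text \<open>The central involutions must act nontrivially.  An orbit on which one of them moves a point has
  at least \<open>order K / m\<close> points, so two such orbits suffice.  If only one orbit is moved, all three
  involutions move it, and a central element that moves one point of an orbit moves every point; thus a
  stabiliser contains no involution, and the orbit has at least \<open>(order K / m)\<^sup>2\<close> points.  The
  hypothesis on \<open>m\<close> makes this at least \<open>2 * order K / m\<close>.\<close>

theorem perm_degree_lower_bound:
  assumes f: "f \<in> mon (K \<times>\<times> K) (sym_group d)" and m: "2 * m \<le> order K"
  shows "2 * order K \<le> d * m"
proof -
  let ?G = "K \<times>\<times> K" and ?n = "order K"
  obtain E where E: "E = {1..d}" "finite E" "card E = d" by simp
  define \<phi> where "\<phi> g = restrict (f g) E" for g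
  have G: "group ?G" by (rule DirProd_group[OF is_group is_group])
  have hom: "f \<in> hom ?G (sym_group d)" and inj: "inj_on f (carrier ?G)"
    using f by (auto simp: mon_def)
  interpret A: group_action ?G "E" \<phi>
    unfolding \<phi>_def E(1) using G hom by (rule hom_sym_group_imp_action)
  have perm: "f g permutes E" if "g \<in> carrier ?G" for g
    using hom that E(1) by (auto simp: hom_def sym_group_def)
  have mult: "f (g \<otimes>\<^bsub>?G\<^esub> h) = f g \<circ> f h" if "g \<in> carrier ?G" "h \<in> carrier ?G" for g h
    using hom_mult[OF hom that] by (simp add: sym_group_mult)
  have id: "f (\<one>, \<one>) = id"
    using hom_one[OF hom G sym_group_is_group] by (simp add: sym_group_def)
  define c where "c = {(z, \<one>), (\<one>, z), (z, z)}"
  have c: "u \<in> carrier ?G" "u \<noteq> (\<one>, \<one>)" "g \<in> carrier ?G \<Longrightarrow> u \<otimes>\<^bsub>?G\<^esub> g = g \<otimes>\<^bsub>?G\<^esub> u"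
    if "u \<in> c" for u g
    using that z_closed z_ne_one z_central by (auto simp: c_def mult_DirProd')
  let ?O = "orbit ?G \<phi>" and ?S = "stabilizer ?G \<phi>"
  have stab: "u \<in> ?S x \<longleftrightarrow> u \<in> carrier ?G \<and> f u x = x" if "x \<in> E" for u x
    using that by (simp add: stabilizer_def \<phi>_def)
  have pos: "0 < ?n" using finite_carrier order_gt_0_iff_finite by simp
  have O: "card (?O x) * card (?S x) = ?n * ?n" if "x \<in> E" for x
    using A.orbit_stabilizer_theorem[OF that] by (simp add: order_def card_cartesian_product)
  \<comment> \<open>An orbit moved by a central involution is large.\<close>
  have big: "?n \<le> card (?O x) * m" if x: "x \<in> E" and u: "u \<in> c" "f u x \<noteq> x" for u x
  proof -
    have "(z, \<one>) \<notin> ?S x \<or> (\<one>, z) \<notin> ?S x"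
    proof (rule ccontr)
      assume "\<not> ?thesis"
      then have "f (z, \<one>) x = x" "f (\<one>, z) x = x" using stab[OF x] by auto
      moreover have "f (z, z) = f (z, \<one>) \<circ> f (\<one>, z)"
        using mult[of "(z, \<one>)" "(\<one>, z)"] z_closed by simp
      ultimately show False using u by (auto simp: c_def)
    qed
    then have "card (?S x) \<le> ?n * m"
      using card_le_if_misses_central A.stabilizer_subgroup x by blast
    then have "?n * ?n \<le> card (?O x) * (?n * m)"
      using O[OF x] by (metis mult_le_mono2)
    then show ?thesis using pos by (simp add: algebra_simps)
  qed
  have orbit_subset: "?O x \<subseteq> E" if "x \<in> E" for x
    using A.element_image[OF _ that] unfolding orbit_def by blast
  have two: "2 * ?n \<le> d * m"
    if x: "x \<in> E" "u \<in> c" "f u x \<noteq> x" and y: "y \<in> E" "v \<in> c" "f v y \<noteq> y"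
      and ne: "y \<notin> ?O x" for x y u v
  proof -
    have "?O x \<inter> ?O y = {}"
    proof (rule ccontr)
      assume "?O x \<inter> ?O y \<noteq> {}"
      then obtain w where w: "w \<in> ?O x" "w \<in> ?O y" by auto
      then have "w \<in> E" using orbit_subset x by auto
      then show False using w ne A.orbit_sym A.orbit_trans x y by blast
    qed
    then have "card (?O x) + card (?O y) = card (?O x \<union> ?O y)"
      using orbit_subset x y by (metis card_Un_disjoint E(2) finite_subset)
    also have "\<dots> \<le> d"
      using orbit_subset[OF x(1)] orbit_subset[OF y(1)] card_mono[of E "?O x \<union> ?O y"] E by simp
    finally have "card (?O x) * m + card (?O y) * m \<le> d * m"
      by (metis add_mult_distrib mult_le_mono1)
    then show ?thesis using big[OF x] big[OF y] by simp
  qed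
  have moved: "\<exists>x \<in> E. f u x \<noteq> x" if "u \<in> c" for u
  proof (rule ccontr)
    assume "\<not> ?thesis"
    then have "f u = id" using permutes_not_in[OF perm[OF c(1)[OF that]]] by fastforce
    then have "u = (\<one>, \<one>)" using inj_onD[OF inj _ c(1)[OF that], of "(\<one>, \<one>)"] id by simp
    then show False using c that by auto
  qed
  \<comment> \<open>Commuting with a transitive action: if \<open>u\<close> fixes one point of an orbit, it fixes all of them.\<close>
  have transfer: "f u x \<noteq> x"
    if x: "x \<in> E" and u: "u \<in> c" and y: "y \<in> ?O x" "f u y \<noteq> y" for x y u
  proof
    assume fixed: "f u x = x"
    obtain g where g: "g \<in> carrier ?G" "y = f g x"
      using y x by (auto simp: orbit_def \<phi>_def)
    have "f u (f g x) = f g (f u x)"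
      using mult[OF g(1) c(1)[OF u]] mult[OF c(1)[OF u] g(1)] c(3)[OF u g(1)]
      by (metis comp_apply)
    then show False using fixed g y by simp
  qed
  obtain x where x: "x \<in> E" "f (z, \<one>) x \<noteq> x" using moved[of "(z, \<one>)"] by (auto simp: c_def)
  show ?thesis
  proof (cases "\<forall>u\<in>c. f u x \<noteq> x")
    case True
    then have "card (?S x) \<le> m * m"
      using card_le_if_no_involution[OF A.stabilizer_subgroup[OF x(1)]] stab[OF x(1)]
      by (auto simp: c_def)
    then have "?n * ?n \<le> card (?O x) * (m * m)" using O[OF x(1)] by (metis mult_le_mono2)
    also have "\<dots> \<le> d * (m * m)"
      using card_mono[OF E(2) orbit_subset[OF x(1)]] E(3) by simp
    finally have "?n * ?n \<le> d * (m * m)" .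
    moreover have "2 * m * ?n \<le> ?n * ?n" using m by (rule mult_le_mono1)
    ultimately have "2 * m * ?n \<le> d * (m * m)" by linarith
    then have "m * (2 * ?n) \<le> m * (d * m)" by (simp add: mult.commute mult.left_commute)
    moreover have "m > 0" using big[OF x(1) _ x(2)] pos by (cases "m = 0") (simp_all add: c_def)
    ultimately show ?thesis by simp
  next
    case False
    then obtain u where u: "u \<in> c" "f u x = x" by auto
    obtain y where y: "y \<in> E" "f u y \<noteq> y" using moved[OF u(1)] by auto
    have "y \<notin> ?O x" using transfer[OF x(1) u(1)] y u by blast
    then show ?thesis using two[OF x(1) _ x(2) y(1) u(1) y(2)] by (simp add: c_def)
  qed
qed

end

text \<open>The group acts on the right cosets of \<open>P\<close>, with kernel the largest normal subgroup contained in
  \<open>P\<close>; the two factors act on two disjoint copies.\<close>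

theorem (in group) coset_embedding:
  assumes fin: "finite (carrier G)" and P: "subgroup P G"
    and core: "\<And>c. \<lbrakk>c \<in> carrier G; \<And>a. a \<in> carrier G \<Longrightarrow> a \<otimes> c \<otimes> inv a \<in> P\<rbrakk> \<Longrightarrow> c = \<one>"
  shows "mon (G \<times>\<times> G) (sym_group (2 * card (rcosets P))) \<noteq> {}"
proof -
  let ?R = "rcosets P"
  \<comment> \<open>The inverse turns right translation into a left action; outside the cosets \<open>t g\<close> must be the identity.\<close>
  define t where "t g C = (if C \<in> ?R then C #> inv g else C)" for g C
  have PG: "P \<subseteq> carrier G" using P by (rule subgroup.subset)
  have sub: "C \<subseteq> carrier G" if "C \<in> ?R" for C
    using that PG by (auto simp: RCOSETS_def r_coset_def)
  have closed: "C #> g \<in> ?R" if C: "C \<in> ?R" and g: "g \<in> carrier G" for C g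
  proof -
    obtain a where a: "a \<in> carrier G" "C = P #> a" using C by (auto simp: RCOSETS_def)
    then have "C #> g = P #> (a \<otimes> g)" using PG g by (simp add: coset_mult_assoc)
    then show ?thesis using a g PG by (simp add: rcosetsI)
  qed
  have t_mult: "t (g \<otimes> h) = t g \<circ> t h" if "g \<in> carrier G" "h \<in> carrier G" for g h
    using that closed sub by (auto simp: t_def fun_eq_iff inv_mult_group coset_mult_assoc)
  have t_one: "t \<one> = id" using sub by (auto simp: t_def fun_eq_iff)
  have t_inj: "g = h" if gh: "g \<in> carrier G" "h \<in> carrier G" and eq: "t g = t h" for g h
  proof -
    let ?c = "inv g \<otimes> h"
    have "?c = \<one>"
    proof (rule core)
      fix a assume a: "a \<in> carrier G"
      have "P #> a #> inv g = P #> a #> inv h"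
        using fun_cong[OF eq, of "P #> a"] a PG by (simp add: t_def rcosetsI)
      then have "P #> (a \<otimes> inv g) = P #> (a \<otimes> inv h)"
        using a gh PG by (simp add: coset_mult_assoc)
      then have "P #> (a \<otimes> inv g \<otimes> inv (a \<otimes> inv h)) = P"
        using coset_mult_inv2[OF _ _ _ PG] a gh by simp
      then have "a \<otimes> inv g \<otimes> inv (a \<otimes> inv h) \<in> P"
        using coset_join1[OF _ _ P] a gh by simp
      then show "a \<otimes> ?c \<otimes> inv a \<in> P" using a gh by (simp add: inv_mult_group m_assoc)
    qed (use gh in simp)
    then show ?thesis using gh by (metis inv_closed inv_inv inv_equality)
  qed
  define act where "act = (\<lambda>(g, h). map_sum (t g) (t h))"
  show ?thesis
  proof (rule mon_sym_group_transport[of "?R <+> ?R" _ _ act])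
    have finR: "finite ?R" using fin sub by (meson PowI finite_Pow_iff finite_subset subsetI)
    then show "finite (?R <+> ?R)" "card (?R <+> ?R) = 2 * card ?R"
      by (simp_all add: card_Plus)
    show mult: "act (x \<otimes>\<^bsub>G \<times>\<times> G\<^esub> y) = act x \<circ> act y"
      if "x \<in> carrier (G \<times>\<times> G)" "y \<in> carrier (G \<times>\<times> G)" for x y
      using that by (auto simp: act_def t_mult map_sum.comp)
    show "act x permutes (?R <+> ?R)" if x: "x \<in> carrier (G \<times>\<times> G)" for x
    proof -
      obtain g h where gh: "x = (g, h)" "g \<in> carrier G" "h \<in> carrier G" using x by auto
      have "act (inv g, inv h) \<circ> act x = id" "act x \<circ> act (inv g, inv h) = id"
        using mult[of "(inv g, inv h)" x] mult[of x "(inv g, inv h)"] gh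
        by (simp_all add: act_def t_one map_sum.id)
      then have "bij (act x)" by (rule o_bij)
      moreover have "act x s = s" if "s \<notin> ?R <+> ?R" for s
        using that gh by (cases s) (auto simp: act_def t_def)
      ultimately show ?thesis by (simp add: permutes_def bij_iff)
    qed
    show "inj_on act (carrier (G \<times>\<times> G))"
    proof (rule inj_onI, clarify)
      fix g h g' h' assume mem: "(g, h) \<in> carrier (G \<times>\<times> G)" "(g', h') \<in> carrier (G \<times>\<times> G)"
        and eq: "act (g, h) = act (g', h')"
      have "t g = t g'" "t h = t h'"
        using fun_cong[OF eq, of "Inl _"] fun_cong[OF eq, of "Inr _"] by (auto simp: act_def fun_eq_iff)
      then show "g = g' \<and> h = h'" using mem t_inj by auto
    qed
  qed
qed

text \<open>The lower bound needs \<open>2 * m \<le> order K\<close>: the odd number \<open>m\<close> divides the order of \<open>K\<close>,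
  which is even because of \<open>z\<close>.\<close>

theorem (in unique_involution_group) min_perm_degree_square:
  assumes P: "subgroup P K" "odd (card P)" "card P = m"
    and core: "\<And>c. \<lbrakk>c \<in> carrier K; \<And>a. a \<in> carrier K \<Longrightarrow> a \<otimes> c \<otimes> inv a \<in> P\<rbrakk> \<Longrightarrow> c = \<one>"
  shows "min_perm_degree (K \<times>\<times> K) = 2 * (order K div m)"
proof -
  have index: "card (rcosets P) * m = order K" using lagrange[OF P(1)] P(3) by simp
  have m: "0 < m" using P(2,3) by (simp add: odd_pos)
  have "even (order K)"
    using no_involution_if_odd_order[OF _ z_closed z_square] z_ne_one by blast
  then have "card (rcosets P) \<noteq> 1" using index P(2,3) by auto
  moreover have "card (rcosets P) \<noteq> 0"
    using index finite_carrier order_gt_0_iff_finite by (metis less_irrefl mult_0)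
  ultimately have "card (rcosets P) \<ge> 2" by simp
  then have m2: "2 * m \<le> order K" using index by (metis mult_le_mono1)
  have quot: "order K div m = card (rcosets P)" using index m by (metis nonzero_mult_div_cancel_right less_numeral_extra(3))
  show ?thesis
    unfolding min_perm_degree_def quot
  proof (rule Least_equality)
    show "mon (K \<times>\<times> K) (sym_group (2 * card (rcosets P))) \<noteq> {}"
      using coset_embedding[OF finite_carrier P(1) core] by blast
  next
    fix d assume "mon (K \<times>\<times> K) (sym_group d) \<noteq> {}"
    then have "2 * order K \<le> d * m" using perm_degree_lower_bound m2 by blast
    then have "(2 * card (rcosets P)) * m \<le> d * m" using index by (simp only: mult.assoc)
    then show "2 * card (rcosets P) \<le> d" using m mult_le_cancel2 by blast
  qed
qed

section \<open>Finite groups generated by explicit elements\<close>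

text \<open>The elements whose right translation maps \<open>S\<close> onto itself form a group.  By finiteness it contains
  \<open>X\<close>, and it lies inside \<open>S\<close> because \<open>S\<close> contains the unit.  No inverses have to be computed.\<close>

lemma (in group) generate_eqI:
  assumes X: "X \<subseteq> carrier G" and S: "finite S" "S \<subseteq> carrier G" "\<one> \<in> S"
    and closed: "\<And>s x. s \<in> S \<Longrightarrow> x \<in> X \<Longrightarrow> s \<otimes> x \<in> S"
    and gen: "S \<subseteq> generate G X"
  shows "generate G X = S"
proof
  define U where "U = {x \<in> carrier G. (\<lambda>s. s \<otimes> x) ` S = S}"
  have U: "subgroup U G"
  proof (rule subgroupI)
    show "U \<noteq> {}" using S(2) by (auto simp: U_def intro!: exI[of _ \<one>] image_eqI)
    fix x assume x: "x \<in> U"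
    have "(\<lambda>s. s \<otimes> inv x) ` ((\<lambda>s. s \<otimes> x) ` S) = (\<lambda>s. s) ` S"
      unfolding image_image using x S(2) by (intro image_cong) (auto simp: U_def m_assoc)
    then show "inv x \<in> U" using x by (simp add: U_def)
    fix y assume y: "y \<in> U"
    have "(\<lambda>s. s \<otimes> (x \<otimes> y)) ` S = (\<lambda>s. s \<otimes> y) ` ((\<lambda>s. s \<otimes> x) ` S)"
      unfolding image_image using x y S(2) by (intro image_cong) (auto simp: U_def m_assoc)
    then show "x \<otimes> y \<in> U" using x y by (simp add: U_def)
  qed (auto simp: U_def)
  have "X \<subseteq> U"
  proof
    fix x assume x: "x \<in> X"
    have "inj_on (\<lambda>s. s \<otimes> x) S" using x X S(2) by (intro inj_onI) (metis right_cancel subsetD)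
    moreover have "(\<lambda>s. s \<otimes> x) ` S \<subseteq> S" using closed x by blast
    ultimately have "(\<lambda>s. s \<otimes> x) ` S = S" using S(1) endo_inj_surj by blast
    then show "x \<in> U" using x X by (auto simp: U_def)
  qed
  then have "generate G X \<subseteq> U" using U by (rule generate_subgroup_incl)
  then show "generate G X \<subseteq> S"
  proof (rule subset_trans)
    show "U \<subseteq> S" using S(3) by (force simp: U_def)
  qed
qed (rule gen)

text \<open>To recognise a product set as the group generated by \<open>X\<close>, it suffices to move the generators past
  the elements of \<open>B\<close>; for the two binary groups this leaves a handful of identities.\<close>

lemma (in group) generate_product_eqI:
  assumes X: "X \<subseteq> carrier G" and A: "subgroup A G" "finite A"
    and B: "finite B" "B \<subseteq> carrier G" "\<one> \<in> B"
    and closed: "\<And>b x. b \<in> B \<Longrightarrow> x \<in> X \<Longrightarrow> b \<otimes> x \<in> A <#> B"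
    and gen: "A \<subseteq> generate G X" "B \<subseteq> generate G X"
  shows "generate G X = A <#> B"
proof (rule generate_eqI)
  have AG: "A \<subseteq> carrier G" using A(1) by (rule subgroup.subset)
  show "finite (A <#> B)" using A(2) B(1) by (simp add: set_mult_def)
  show "A <#> B \<subseteq> carrier G" using AG B(2) by (rule set_mult_closed)
  have "\<one> \<otimes> \<one> \<in> A <#> B" unfolding set_mult_def using subgroup.one_closed[OF A(1)] B(3) by blast
  then show "\<one> \<in> A <#> B" by simp
  show "A <#> B \<subseteq> generate G X" using gen by (auto simp: set_mult_def intro!: generate.eng)
  fix s x assume s: "s \<in> A <#> B" and x: "x \<in> X"
  then obtain a b where ab: "a \<in> A" "b \<in> B" "s = a \<otimes> b" by (auto simp: set_mult_def)
  obtain a' b' where ab': "a' \<in> A" "b' \<in> B" "b \<otimes> x = a' \<otimes> b'"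
    using closed[OF ab(2) x] by (auto simp: set_mult_def)
  have "a \<in> carrier G" "b \<in> carrier G" "x \<in> carrier G" "a' \<in> carrier G" "b' \<in> carrier G"
    using ab ab' x X AG B by auto
  then have "s \<otimes> x = (a \<otimes> a') \<otimes> b'" using ab(3) ab'(3) by (simp add: m_assoc)
  then show "s \<otimes> x \<in> A <#> B"
    using subgroup.m_closed[OF A(1) ab(1) ab'(1)] ab'(2) by (auto simp: set_mult_def)
qed (rule X)

text \<open>By Lagrange both factors divide the order of the product, and a product set is never larger than the
  product of the cardinalities; so \<open>A \<inter> B\<close> need not be determined.\<close>

lemma (in group) card_coprime_product:
  assumes S: "subgroup S G" "S = A <#> B" "finite A" "finite B"
    and A: "subgroup A G" and B: "subgroup B G" and cop: "coprime (card A) (card B)"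
  shows "card S = card A * card B"
proof -
  have fin: "finite S" using S by (simp add: set_mult_def)
  have AG: "A \<subseteq> carrier G" and BG: "B \<subseteq> carrier G" using A B by (auto dest: subgroup.subset)
  have one: "\<one> \<in> A" "\<one> \<in> B" using A B by (auto dest: subgroup.one_closed)
  have sub: "A \<subseteq> S" "B \<subseteq> S"
  proof -
    show "A \<subseteq> S"
    proof
      fix a assume "a \<in> A"
      moreover then have "a = a \<otimes> \<one>" using AG by auto
      ultimately show "a \<in> S" using one(2) unfolding S(2) set_mult_def by blast
    qed
    show "B \<subseteq> S"
    proof
      fix b assume "b \<in> B"
      moreover then have "b = \<one> \<otimes> b" using BG by auto
      ultimately show "b \<in> S" using one(1) unfolding S(2) set_mult_def by blast
    qed
  qed
  interpret S: group "G\<lparr>carrier := S\<rparr>" using S(1) by (rule subgroup_imp_group)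
  have "card A dvd card S" "card B dvd card S"
    using S.lagrange[OF subgroup_incl[OF A S(1) sub(1)]] S.lagrange[OF subgroup_incl[OF B S(1) sub(2)]]
    by (simp_all add: order_def) (metis dvd_triv_right)+
  then have "card A * card B dvd card S" using cop by (simp add: divides_mult)
  moreover have "card S > 0" using fin sub one by (auto simp: card_gt_0_iff)
  ultimately have ge: "card A * card B \<le> card S" by (simp add: dvd_imp_le)
  have "S = (\<lambda>(a, b). a \<otimes> b) ` (A \<times> B)" unfolding S(2) set_mult_def by auto
  then have "card S \<le> card (A \<times> B)"
    using card_image_le[of "A \<times> B" "\<lambda>(a, b). a \<otimes> b"] S(3,4) by simp
  then show ?thesis using ge by (simp add: card_cartesian_product)
qed

section \<open>Finite groups of quaternions\<close>

lemma Quat_mult: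
  "Quat a b c d * Quat a' b' c' d' =
     Quat (a * a' - b * b' - c * c' - d * d') (a * b' + b * a' + c * d' - d * c')
          (a * c' - b * d' + c * a' + d * b') (a * d' + b * c' - c * b' + d * a')"
  by (simp add: quat_eq_iff)

lemma Quat_minus: "- Quat a b c d = Quat (- a) (- b) (- c) (- d)"
  by (simp add: quat_eq_iff)

lemma Quat_one: "(1 :: quat) = Quat 1 0 0 0"
  by (simp add: quat_eq_iff)

interpretation units: group quat_units by (rule group_quat_units)

lemma quat_units_simps [simp]:
  "carrier quat_units = {q. q \<noteq> 0}" "x \<otimes>\<^bsub>quat_units\<^esub> y = x * y" "\<one>\<^bsub>quat_units\<^esub> = 1"
  by (simp_all add: quat_units_def)

definition quat_norm_sq :: "quat \<Rightarrow> real" where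
  "quat_norm_sq x = (Re0 x)\<^sup>2 + (Im1 x)\<^sup>2 + (Im2 x)\<^sup>2 + (Im3 x)\<^sup>2"

lemma quat_norm_sq_mult: "quat_norm_sq (x * y) = quat_norm_sq x * quat_norm_sq y"
  by (simp add: quat_norm_sq_def power2_eq_square algebra_simps)

lemma Re0_square: "quat_norm_sq x = 1 \<Longrightarrow> Re0 (x * x) = 2 * (Re0 x)\<^sup>2 - 1"
  by (simp add: quat_norm_sq_def power2_eq_square)

lemma Re0_sum: "Re0 (\<Sum>h\<in>H. f h) = (\<Sum>h\<in>H. Re0 (f h))"
  by (induction H rule: infinite_finite_induct) auto

text \<open>Left translation by \<open>g\<close> permutes the summands, so \<open>(g - 1) * \<Sum> H = 0\<close> in a division ring.\<close>

lemma sum_nontrivial_quat_subgroup: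
  assumes H: "subgroup H quat_units" and g: "g \<in> H" "g \<noteq> 1"
  shows "\<Sum> H = 0"
proof -
  have "inj_on (\<lambda>h. g * h) H" using g subgroup.subset[OF H] by (auto simp: inj_on_def)
  have *: "(\<lambda>h. g * h) ` H = H"
    using units.coset_join3[OF _ H g(1)] subgroup.subset[OF H] g(1)
    by (auto simp: l_coset_def)
  have "g * \<Sum> H = (\<Sum>h\<in>H. g * h)" by (simp add: sum_distrib_left)
  also have "\<dots> = \<Sum> ((\<lambda>h. g * h) ` H)" using \<open>inj_on _ H\<close> by (simp add: sum.reindex)
  finally have "(g - 1) * \<Sum> H = 0" using * by (simp add: algebra_simps)
  then show ?thesis using g(2) by simp
qed

text \<open>Squaring is a bijection of a group of odd order, so \<open>h\<close>, \<open>h * h\<close> and \<open>h * h * (h * h)\<close> run through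
  the same elements as \<open>h\<close> runs through \<open>H\<close>.  The sum of \<open>h * h + h * h * (h * h)\<close> therefore vanishes.  On
  real parts the unit contributes 2 and every other element at most \<open>- 2 / (m - 1)\<close>, so there are at most
  \<open>m - 1\<close> other elements.\<close>

lemma odd_quat_subgroup_card_le:
  assumes H: "subgroup H quat_units" "odd (card H)" and m: "m > 1"
    and bound: "\<And>h. \<lbrakk>h \<in> H; h * h \<noteq> 1; h * h \<noteq> - 1\<rbrakk> \<Longrightarrow>
        (real m - 1) * (Re0 (h * h) + Re0 (h * h * (h * h))) \<le> - 2"
  shows "card H \<le> m"
proof (cases "H = {1}")
  case False
  have fin: "finite H" using H(2) by (metis card.infinite even_zero)
  have one: "1 \<in> H" using subgroup.one_closed[OF H(1)] by simp
  have closed: "x * y \<in> H" if "x \<in> H" "y \<in> H" for x y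
    using subgroup.m_closed[OF H(1) that] by simp
  obtain g where g: "g \<in> H" "g \<noteq> 1" using False one by auto
  have sum0: "\<Sum> H = 0" using sum_nontrivial_quat_subgroup[OF H(1) g] .
  interpret HG: group "quat_units\<lparr>carrier := H\<rparr>" using H(1) by (rule units.subgroup_imp_group)
  have no_inv: "x = 1" if "x \<in> H" "x * x = 1" for x
    using HG.no_involution_if_odd_order[of x] that H(2) by (simp add: order_def)
  obtain k where k: "card H = 2 * k + 1" using H(2) by (elim oddE)
  have pow: "x ^ n \<in> H" if "x \<in> H" for x n using that one closed by (induction n) auto
  have pow_card: "x ^ card H = 1" if "x \<in> H" for x
  proof -
    have "x [^]\<^bsub>quat_units\<lparr>carrier := H\<rparr>\<^esub> n = x ^ n" for n :: nat
      by (induction n) (simp_all add: power_commutes)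
    then show ?thesis using HG.pow_order_eq_1[of x] that by (simp add: order_def)
  qed
  have inj: "inj_on (\<lambda>x. x * x) H"
  proof (rule inj_onI)
    fix x y assume xy: "x \<in> H" "y \<in> H" "x * x = y * y"
    \<comment> \<open>The exponent \<open>k + 1\<close> is the inverse of 2 modulo the order \<open>2 * k + 1\<close> of \<open>H\<close>.\<close>
    have root: "u = (u * u) ^ (k + 1)" if "u \<in> H" for u
    proof -
      have "(u * u) ^ (k + 1) = u ^ (2 * (k + 1))" by (simp only: power_mult power2_eq_square)
      also have "2 * (k + 1) = Suc (card H)" using k by simp
      also have "u ^ Suc (card H) = u" using pow_card[OF that] by simp
      finally show ?thesis ..
    qed
    show "x = y" using root[OF xy(1)] root[OF xy(2)] xy(3) by simp
  qed
  have sq: "(\<lambda>x. x * x) ` H = H"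
    using inj fin closed by (intro endo_inj_surj) auto
  have sum_sq: "(\<Sum>h\<in>H. F (h * h)) = sum F H" for F :: "quat \<Rightarrow> quat"
    using sum.reindex[OF inj, of F] sq by simp
  let ?f = "\<lambda>h. Re0 (h * h) + Re0 (h * h * (h * h))"
  have "(\<Sum>h\<in>H. h * h) = 0" "(\<Sum>h\<in>H. h * h * (h * h)) = 0"
    using sum_sq[of "\<lambda>h. h"] sum_sq[of "\<lambda>h. h * h"] sum0 by auto
  then have "sum ?f H = 0"
    unfolding sum.distrib Re0_sum[symmetric] by simp
  then have total: "sum ?f (H - {1}) = - 2" using fin one by (simp add: sum.remove)
  have "(real m - 1) * ?f h \<le> - 2" if "h \<in> H - {1}" for h
  proof (rule bound)
    show "h \<in> H" using that by simp
    show "h * h \<noteq> 1" using no_inv that by blast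
    show "h * h \<noteq> - 1"
    proof
      assume eq: "h * h = - 1"
      then have "(- 1 :: quat) = 1" using no_inv[of "- 1"] closed[of h h] that by simp
      then show False by (simp add: quat_eq_iff)
    qed
  qed
  then have "(\<Sum>h\<in>H - {1}. (real m - 1) * ?f h) \<le> (\<Sum>h\<in>H - {1}. - 2)"
    by (intro sum_mono)
  then have "(real m - 1) * (- 2) \<le> real (card (H - {1})) * (- 2)"
    unfolding sum_distrib_left[symmetric] total by simp
  then have "real (card (H - {1})) \<le> real m - 1" by simp
  moreover have "card (H - {1}) = card H - 1" using one by simp
  moreover have "card H > 0" using fin one by (auto simp: card_gt_0_iff)
  ultimately show ?thesis by linarith
qed (use m in simp)

text \<open>In a division ring \<open>x * x = 1\<close> forces \<open>x = 1\<close> or \<open>x = - 1\<close>, so \<open>- 1\<close> is the unique involution.  The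
  \<open>plane\<close> conditions say that \<open>P\<close> lies in \<open>{p. Im2 p = t * Im1 p}\<close>.  Conjugation by \<^const>\<open>quat_i\<close> changes
  the sign of \<^const>\<open>Im2\<close> and keeps \<^const>\<open>Im1\<close>, so \<open>P\<close> meets its conjugate only in 1 and contains no
  nontrivial normal subgroup.\<close>

theorem quat_min_perm_degree_square:
  assumes S: "subgroup S quat_units" "finite S" "- 1 \<in> S" "quat_i \<in> S"
    and P: "subgroup P quat_units" "P \<subseteq> S" "odd (card P)" "card P > 1"
    and plane: "t \<noteq> 0" "\<And>p. p \<in> P \<Longrightarrow> Im2 p = t * Im1 p" "\<And>p. p \<in> P \<Longrightarrow> Im1 p = 0 \<Longrightarrow> p = 1"
    and bound: "\<And>h. \<lbrakk>h \<in> S; h * h \<noteq> 1; h * h \<noteq> - 1\<rbrakk> \<Longrightarrow>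
        (real (card P) - 1) * (Re0 (h * h) + Re0 (h * h * (h * h))) \<le> - 2"
  defines "K \<equiv> quat_units\<lparr>carrier := S\<rparr>"
  shows "min_perm_degree (K \<times>\<times> K) = 2 * (card S div card P)"
proof -
  have K [simp]: "carrier K = S" "x \<otimes>\<^bsub>K\<^esub> y = x * y" "\<one>\<^bsub>K\<^esub> = 1" for x y
    by (simp_all add: K_def)
  interpret K: group K unfolding K_def using S(1) by (rule units.subgroup_imp_group)
  have sub_units: "subgroup H quat_units" if "subgroup H K" for H
    using units.incl_subgroup[OF S(1)] that by (simp add: K_def)
  interpret K: unique_involution_group K "- 1" "card P"
  proof
    show "finite (carrier K)" "- 1 \<in> carrier K" "- 1 \<otimes>\<^bsub>K\<^esub> - 1 = \<one>\<^bsub>K\<^esub>" using S by simp_all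
    show "- 1 \<noteq> \<one>\<^bsub>K\<^esub>" by (simp add: quat_eq_iff)
    show "x = \<one>\<^bsub>K\<^esub> \<or> x = - 1" if "x \<otimes>\<^bsub>K\<^esub> x = \<one>\<^bsub>K\<^esub>" for x
      using that square_eq_1_iff[of x] by simp
    fix H assume H: "subgroup H K" "odd (card H)"
    show "card H \<le> card P"
      using odd_quat_subgroup_card_le[OF sub_units[OF H(1)] H(2) P(4)] bound subgroup.subset[OF H(1)]
      by auto
  qed
  have "min_perm_degree (K \<times>\<times> K) = 2 * (order K div card P)"
  proof (rule K.min_perm_degree_square)
    show "subgroup P K" using units.subgroup_incl[OF P(1) S(1) P(2)] by (simp add: K_def)
    fix c assume c: "c \<in> carrier K" "\<And>a. a \<in> carrier K \<Longrightarrow> a \<otimes>\<^bsub>K\<^esub> c \<otimes>\<^bsub>K\<^esub> inv\<^bsub>K\<^esub> a \<in> P"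
    have "- quat_i = - 1 * quat_i" by simp
    then have "- quat_i \<in> S" using subgroup.m_closed[OF S(1) S(3,4)] by simp
    then have inv_i: "inv\<^bsub>K\<^esub> quat_i = - quat_i"
      using K.inv_equality[of "- quat_i" quat_i] S(4) by (simp add: quat_units_relations)
    have cP: "c \<in> P" using c(2)[of 1] c(1) S(1) K.one_closed K.inv_one by simp
    have "quat_i * c * - quat_i \<in> P" using c(2)[of quat_i] S(4) inv_i by simp
    moreover have "Im1 (quat_i * c * - quat_i) = Im1 c" "Im2 (quat_i * c * - quat_i) = - Im2 c"
      by (simp_all add: quat_i_def)
    ultimately have "- Im2 c = t * Im1 c" using plane(2) by metis
    then have "t * Im1 c = 0" using plane(2)[OF cP] by simp
    then show "c = \<one>\<^bsub>K\<^esub>" using plane(1,3) cP by simp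
  qed (use P in simp_all)
  then show ?thesis by (simp add: order_def)
qed

section \<open>The binary tetrahedral and icosahedral groups\<close>

lemma omega_eq: "omega = Quat (- 1 / 2) (1 / 2) (1 / 2) (1 / 2)"
  by (simp add: quat_eq_iff omega_def quat_i_def quat_j_def quat_k_def)

lemma tau_square: "tau * tau = tau + 1"
  by (simp add: tau_def field_simps)

lemma tau_tau_mult: "tau * (tau * x) = (tau + 1) * x"
  by (simp flip: tau_square)

lemma tau_gt: "tau > 1"
  by (simp add: tau_def)

lemma inverse_tau: "inverse tau = tau - 1"
  using tau_square tau_gt by (simp add: field_simps)

lemma sigma_eq: "sigma = Quat ((tau - 1) / 2) (1 / 2) (tau / 2) 0"
  by (simp add: quat_eq_iff sigma_def quat_i_def quat_j_def inverse_tau of_real_def)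

lemma Q8_eq: "Q8 = {Quat 1 0 0 0, Quat (- 1) 0 0 0, Quat 0 1 0 0, Quat 0 (- 1) 0 0,
    Quat 0 0 1 0, Quat 0 0 (- 1) 0, Quat 0 0 0 1, Quat 0 0 0 (- 1)}"
  by (simp add: Q8_def quat_i_def quat_j_def quat_k_def Quat_one Quat_minus)

lemma card_Q8: "card Q8 = 8" by (simp add: Q8_eq)

lemma generate_i_j: "generate quat_units {quat_i, quat_j} = Q8"
proof (rule units.generate_eqI)
  let ?g = "generate quat_units {quat_i, quat_j}"
  have i: "quat_i \<in> ?g" and j: "quat_j \<in> ?g" by (auto intro: generate.incl)
  have mult: "x * y \<in> ?g" if "x \<in> ?g" "y \<in> ?g" for x y
    using generate.eng[OF that] by simp
  have 1: "1 \<in> ?g" using generate.one[of quat_units] by simp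
  have m: "- 1 \<in> ?g" using mult[OF i i] by (simp add: quat_units_relations)
  have k: "quat_k \<in> ?g" using mult[OF i j] by (simp add: quat_units_relations)
  show "Q8 \<subseteq> ?g"
    using 1 m i j k mult[OF m i] mult[OF m j] mult[OF m k] by (simp add: Q8_def)
  show "s \<otimes>\<^bsub>quat_units\<^esub> x \<in> Q8" if "s \<in> Q8" "x \<in> {quat_i, quat_j}" for s x
    using that by (auto simp: Q8_eq Quat_mult quat_i_def quat_j_def)
qed (auto simp: Q8_eq quat_i_def quat_j_def quat_eq_iff)

lemma subgroup_Q8: "subgroup Q8 quat_units"
  unfolding generate_i_j[symmetric]
  by (rule units.generate_is_subgroup) (auto simp: quat_i_def quat_j_def quat_eq_iff)

text \<open>The powers of \<^const>\<open>omega\<close> and \<^const>\<open>sigma\<close> in coordinates.  The entries are affine in \<^const>\<open>tau\<close>, and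
  an element of \<open>Q8\<close> times a power of \<^const>\<open>omega\<close> is rational; so products of the form
  \<open>q * w * s\<close> stay affine in \<^const>\<open>tau\<close>.\<close>

definition omega_powers :: "quat set" where
  "omega_powers = {Quat 1 0 0 0, Quat (- 1 / 2) (1 / 2) (1 / 2) (1 / 2),
     Quat (- 1 / 2) (- 1 / 2) (- 1 / 2) (- 1 / 2)}"

definition sigma_powers :: "quat set" where
  "sigma_powers = {Quat 1 0 0 0, Quat ((tau - 1) / 2) (1 / 2) (tau / 2) 0,
     Quat (- tau / 2) ((tau - 1) / 2) (1 / 2) 0, Quat (- tau / 2) ((1 - tau) / 2) (- 1 / 2) 0,
     Quat ((tau - 1) / 2) (- 1 / 2) (- tau / 2) 0}"

lemma generate_omega: "generate quat_units {omega} = omega_powers"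
proof (rule units.generate_eqI)
  let ?g = "generate quat_units {omega}"
  have w: "omega \<in> ?g" by (auto intro: generate.incl)
  have "omega * omega \<in> ?g" using generate.eng[OF w w] by simp
  moreover have "1 \<in> ?g" using generate.one[of quat_units] by simp
  ultimately show "omega_powers \<subseteq> ?g"
    using w by (simp add: omega_powers_def omega_eq Quat_mult Quat_one)
  show "s \<otimes>\<^bsub>quat_units\<^esub> x \<in> omega_powers" if "s \<in> omega_powers" "x \<in> {omega}" for s x
    using that by (auto simp: omega_powers_def omega_eq Quat_mult Quat_one)
qed (auto simp: omega_powers_def omega_eq quat_eq_iff)

lemma generate_sigma: "generate quat_units {sigma} = sigma_powers"
proof (rule units.generate_eqI)
  let ?g = "generate quat_units {sigma}"
  have w: "sigma \<in> ?g" by (auto intro: generate.incl)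
  have w2: "sigma * sigma \<in> ?g" using generate.eng[OF w w] by simp
  have w3: "sigma * sigma * sigma \<in> ?g" using generate.eng[OF w2 w] by simp
  have w4: "sigma * sigma * sigma * sigma \<in> ?g" using generate.eng[OF w3 w] by simp
  have one: "1 \<in> ?g" using generate.one[of quat_units] by simp
  have s2: "sigma * sigma = Quat (- tau / 2) ((tau - 1) / 2) (1 / 2) 0"
    by (simp add: sigma_eq Quat_mult field_simps tau_square)
  have s3: "Quat (- tau / 2) ((tau - 1) / 2) (1 / 2) 0 * sigma = Quat (- tau / 2) ((1 - tau) / 2) (- 1 / 2) 0"
    by (simp add: sigma_eq Quat_mult field_simps tau_square)
  have s4: "Quat (- tau / 2) ((1 - tau) / 2) (- 1 / 2) 0 * sigma = Quat ((tau - 1) / 2) (- 1 / 2) (- tau / 2) 0"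
    by (simp add: sigma_eq Quat_mult field_simps tau_square)
  have s5: "Quat ((tau - 1) / 2) (- 1 / 2) (- tau / 2) 0 * sigma = Quat 1 0 0 0"
    by (simp add: sigma_eq Quat_mult field_simps tau_square)
  have powers: "sigma_powers = {1, sigma, sigma * sigma, sigma * sigma * sigma, sigma * sigma * sigma * sigma}"
    by (simp only: s2 s3 s4 sigma_powers_def) (simp only: sigma_eq Quat_one)
  show "sigma_powers \<subseteq> ?g"
    using one w w2 w3 w4 by (simp add: powers)
  show "s \<otimes>\<^bsub>quat_units\<^esub> x \<in> sigma_powers" if "s \<in> sigma_powers" "x \<in> {sigma}" for s x
  proof -
    from that have "s \<in> {1, sigma, sigma * sigma, sigma * sigma * sigma, sigma * sigma * sigma * sigma}"
      and x: "x = sigma" by (simp_all only: powers singleton_iff)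
    moreover have "sigma * sigma * sigma * sigma * sigma = 1"
      by (simp only: s2 s3 s4 s5 Quat_one)
    ultimately have "s * sigma \<in> sigma_powers" unfolding powers by auto
    then show ?thesis using x by simp
  qed
qed (use tau_gt in \<open>auto simp: sigma_powers_def sigma_eq quat_eq_iff\<close>)

lemma subgroup_omega_powers: "subgroup omega_powers quat_units"
  unfolding generate_omega[symmetric]
  by (rule units.generate_is_subgroup) (auto simp: omega_eq quat_eq_iff)

lemma subgroup_sigma_powers: "subgroup sigma_powers quat_units"
  unfolding generate_sigma[symmetric]
  by (rule units.generate_is_subgroup) (auto simp: sigma_eq quat_eq_iff)

lemma card_omega_powers: "card omega_powers = 3"
  by (simp add: omega_powers_def)

lemma card_sigma_powers: "card sigma_powers = 5"
  using tau_gt by (simp add: sigma_powers_def)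

lemma carrier_binary_tetrahedral:
  "carrier binary_tetrahedral = Q8 <#>\<^bsub>quat_units\<^esub> omega_powers"
  by (simp add: binary_tetrahedral_def generate_omega)

abbreviation "tetra \<equiv> carrier binary_tetrahedral"

lemma tetra_memI: "q \<in> Q8 \<Longrightarrow> w \<in> omega_powers \<Longrightarrow> x = q * w \<Longrightarrow> x \<in> tetra"
  by (auto simp: carrier_binary_tetrahedral set_mult_def)

text \<open>Conjugation by \<^const>\<open>omega\<close> permutes \<open>i\<close>, \<open>j\<close>, \<open>k\<close> cyclically.  Hence \<open>i\<close> and
  \<^const>\<open>omega\<close> generate \<open>Q8\<close>, and \<open>i\<close> can be moved past powers of \<^const>\<open>omega\<close>.\<close>

lemma generate_i_omega: "generate quat_units {quat_i, omega} = tetra"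
  unfolding carrier_binary_tetrahedral
proof (rule units.generate_product_eqI[OF _ subgroup_Q8])
  let ?g = "generate quat_units {quat_i, omega}"
  have sub: "subgroup ?g quat_units"
    by (rule units.generate_is_subgroup) (auto simp: quat_i_def omega_eq quat_eq_iff)
  have i: "quat_i \<in> ?g" and w: "omega \<in> ?g" by (auto intro: generate.incl)
  have mult: "x * y \<in> ?g" if "x \<in> ?g" "y \<in> ?g" for x y
    using generate.eng[OF that] by simp
  have "omega * quat_i * (omega * omega) = quat_k"
    by (simp add: omega_eq quat_i_def quat_k_def Quat_mult)
  then have "quat_k \<in> ?g" using mult[OF mult[OF w i] mult[OF w w]] by simp
  from mult[OF this i] have "quat_j \<in> ?g" by (simp add: quat_units_relations)
  then show "Q8 \<subseteq> ?g"
    unfolding generate_i_j[symmetric] using i by (intro units.generate_subgroup_incl[OF _ sub]) auto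
  show "omega_powers \<subseteq> ?g"
    unfolding generate_omega[symmetric] using w by (intro units.generate_subgroup_incl[OF _ sub]) auto
  fix b x assume b: "b \<in> omega_powers" and x: "x \<in> {quat_i, omega}"
  have "b * omega \<in> omega_powers"
    using b by (auto simp: omega_powers_def omega_eq Quat_mult Quat_one)
  moreover have "\<exists>q\<in>Q8. b * quat_i = q * b"
    using b unfolding Q8_eq omega_powers_def by (auto simp: quat_i_def Quat_mult Quat_one)
  ultimately have "\<exists>q\<in>Q8. \<exists>w\<in>omega_powers. b * x = q * w"
    using b x subgroup.one_closed[OF subgroup_Q8] by auto (metis mult_1)
  then show "b \<otimes>\<^bsub>quat_units\<^esub> x \<in> Q8 <#>\<^bsub>quat_units\<^esub> omega_powers"
    by (auto simp: set_mult_def)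
qed (auto simp: Q8_eq omega_powers_def omega_eq quat_i_def quat_eq_iff)

lemma subgroup_tetra: "subgroup tetra quat_units"
  unfolding generate_i_omega[symmetric]
  by (rule units.generate_is_subgroup) (auto simp: quat_i_def omega_eq quat_eq_iff)

lemma coprime_8_3: "coprime (8::nat) 3" and coprime_24_5: "coprime (24::nat) 5"
  by code_simp+

lemma card_tetra: "card tetra = 24"
  using units.card_coprime_product[OF subgroup_tetra carrier_binary_tetrahedral _ _ subgroup_Q8 subgroup_omega_powers]
    coprime_8_3
  by (simp add: card_Q8 card_omega_powers card_ge_0_finite)

text \<open>The table of how \<open>i\<close> and \<^const>\<open>omega\<close> permute the five cosets \<open>tetra * s\<close> with \<open>s\<close> a power of
  \<^const>\<open>sigma\<close>.  The three factors on the right are unique, as the group has order \<open>8 * 3 * 5\<close>.\<close>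

lemma sigma_powers_times_generators:
  assumes s: "s \<in> sigma_powers" and x: "x \<in> {quat_i, omega}"
  shows "\<exists>q\<in>Q8. \<exists>w\<in>omega_powers. \<exists>s'\<in>sigma_powers. s * x = q * w * s'"
proof -
  let ?w2 = "Quat (- 1 / 2) (- 1 / 2) (- 1 / 2) (- 1 / 2)"
  let ?s2 = "Quat (- tau / 2) ((tau - 1) / 2) (1 / 2) 0"
  let ?s3 = "Quat (- tau / 2) ((1 - tau) / 2) (- 1 / 2) 0"
  let ?s4 = "Quat ((tau - 1) / 2) (- 1 / 2) (- tau / 2) 0"
  have mem: "omega \<in> omega_powers" "?w2 \<in> omega_powers" "1 \<in> omega_powers"
    "1 \<in> sigma_powers" "sigma \<in> sigma_powers" "?s2 \<in> sigma_powers" "?s3 \<in> sigma_powers" "?s4 \<in> sigma_powers"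
    by (simp_all add: omega_powers_def sigma_powers_def omega_eq sigma_eq Quat_one)
  have Q: "1 \<in> Q8" "- 1 \<in> Q8" "quat_i \<in> Q8" "- quat_i \<in> Q8" "- quat_j \<in> Q8" "quat_k \<in> Q8" "- quat_k \<in> Q8"
    by (simp_all add: Q8_def)
  note eqs = quat_eq_iff omega_eq sigma_eq quat_i_def quat_j_def quat_k_def
  have i: "1 * quat_i = quat_i * 1 * 1"
    "sigma * quat_i = (- quat_j) * omega * ?s2"
    "?s2 * quat_i = (- quat_k) * ?w2 * sigma"
    "?s3 * quat_i = quat_i * ?w2 * ?s4"
    "?s4 * quat_i = quat_k * omega * ?s3"
    by (simp_all add: eqs field_simps)
  have w: "1 * omega = 1 * omega * 1"
    "sigma * omega = (- quat_j) * ?w2 * sigma"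
    "?s2 * omega = (- 1) * ?w2 * ?s3"
    "?s3 * omega = (- quat_i) * omega * ?s4"
    "?s4 * omega = (- quat_j) * 1 * ?s2"
    by (simp_all add: eqs field_simps)
  have "s \<in> {1, sigma, ?s2, ?s3, ?s4}"
    using s by (simp add: sigma_powers_def sigma_eq Quat_one)
  then show ?thesis
    using x i w mem Q by (elim insertE emptyE) (metis+)
qed

text \<open>The icosahedral group is the product of a point stabiliser (tetrahedral) and a transitive cyclic
  group of order 5 in its action on five objects.  The table above yields closure of the product set under
  right multiplication by the generators.\<close>

lemma carrier_binary_icosahedral: "carrier binary_icosahedral = tetra <#>\<^bsub>quat_units\<^esub> sigma_powers"
proof -
  have s0: "sigma \<noteq> 0" by (simp add: sigma_eq quat_eq_iff)
  have fin: "finite tetra" using card_tetra card.infinite by fastforce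
  let ?g = "generate quat_units (tetra \<union> {sigma})"
  let ?h = "generate quat_units {quat_i, omega, sigma}"
  have subh: "subgroup ?h quat_units"
    by (rule units.generate_is_subgroup) (use s0 in \<open>auto simp: quat_i_def omega_eq quat_eq_iff\<close>)
  have h: "?h = tetra <#>\<^bsub>quat_units\<^esub> sigma_powers"
  proof (rule units.generate_product_eqI[OF _ subgroup_tetra fin])
    show "tetra \<subseteq> ?h" unfolding generate_i_omega[symmetric]
      by (intro units.generate_subgroup_incl[OF _ subh]) (auto intro: generate.incl)
    show "sigma_powers \<subseteq> ?h" unfolding generate_sigma[symmetric]
      by (intro units.generate_subgroup_incl[OF _ subh]) (auto intro: generate.incl)
    fix s x assume s: "s \<in> sigma_powers" and x: "x \<in> {quat_i, omega, sigma}"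
    have "\<exists>t\<in>tetra. \<exists>s'\<in>sigma_powers. s * x = t * s'"
    proof (cases "x = sigma")
      case True
      have "sigma \<in> sigma_powers" by (simp add: sigma_powers_def sigma_eq)
      then have "s * sigma \<in> sigma_powers" using subgroup.m_closed[OF subgroup_sigma_powers s] by simp
      then show ?thesis using True subgroup.one_closed[OF subgroup_tetra] by (metis mult_1 quat_units_simps(3))
    next
      case False
      then show ?thesis using sigma_powers_times_generators[OF s] x tetra_memI by (metis insert_iff)
    qed
    then show "s \<otimes>\<^bsub>quat_units\<^esub> x \<in> tetra <#>\<^bsub>quat_units\<^esub> sigma_powers" by (auto simp: set_mult_def)
  qed (use s0 tau_gt in \<open>auto simp: sigma_powers_def omega_eq quat_i_def quat_eq_iff\<close>)
  have "?g = ?h"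
  proof
    have "tetra \<subseteq> ?h" unfolding generate_i_omega[symmetric]
      by (intro units.generate_subgroup_incl[OF _ subh]) (auto intro: generate.incl)
    then show "?g \<subseteq> ?h"
      by (intro units.generate_subgroup_incl[OF _ subh]) (auto intro: generate.incl)
    have "quat_i \<in> tetra" "omega \<in> tetra" unfolding generate_i_omega[symmetric] by (auto intro: generate.incl)
    then show "?h \<subseteq> ?g" by (intro units.mono_generate) auto
  qed
  then show ?thesis using h by (simp add: binary_icosahedral_def)
qed


abbreviation "icosa \<equiv> carrier binary_icosahedral"

lemma subgroup_icosa: "subgroup icosa quat_units"
proof -
  have "tetra \<union> {sigma} \<subseteq> carrier quat_units"
    using subgroup.subset[OF subgroup_tetra] by (auto simp: sigma_eq quat_eq_iff)
  then show ?thesis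
    unfolding binary_icosahedral_def by (simp add: units.generate_is_subgroup)
qed

lemma card_icosa: "card icosa = 120"
  using units.card_coprime_product[OF subgroup_icosa carrier_binary_icosahedral _ _ subgroup_tetra subgroup_sigma_powers]
    coprime_24_5
  by (simp add: card_tetra card_sigma_powers card_ge_0_finite)

lemma icosa_memE:
  assumes "x \<in> icosa"
  obtains q w s where "q \<in> Q8" "w \<in> omega_powers" "s \<in> sigma_powers" "x = q * w * s"
  using assms by (auto simp: carrier_binary_icosahedral carrier_binary_tetrahedral set_mult_def)

lemma tetra_subset_icosa: "tetra \<subseteq> icosa"
  by (auto simp: binary_icosahedral_def intro: generate.incl)

lemma norm_icosa: assumes "x \<in> icosa" shows "quat_norm_sq x = 1"
proof -
  have "quat_norm_sq q = 1" if "q \<in> Q8" for q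
    using that by (auto simp: Q8_eq quat_norm_sq_def)
  moreover have "quat_norm_sq w = 1" if "w \<in> omega_powers" for w
    using that by (auto simp: omega_powers_def quat_norm_sq_def power2_eq_square)
  moreover have "quat_norm_sq s = 1" if "s \<in> sigma_powers" for s
    using that
    by (auto simp: sigma_powers_def quat_norm_sq_def power2_eq_square field_simps tau_square)
  ultimately show ?thesis using assms by (elim icosa_memE) (simp add: quat_norm_sq_mult)
qed

lemma Re0_tetra: assumes "x \<in> tetra" shows "Re0 x \<in> {0, 1, -1, 1 / 2, - 1 / 2}"
proof -
  obtain q w where x: "q \<in> Q8" "w \<in> omega_powers" "x = q * w"
    using assms by (auto simp: carrier_binary_tetrahedral set_mult_def)
  then show ?thesis unfolding Q8_eq omega_powers_def by (auto simp: Quat_mult)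
qed

text \<open>The values are the cosines of the multiples of \<open>pi / 2\<close>, \<open>pi / 3\<close> and \<open>pi / 5\<close>, as the
  orders of elements divide 4, 6 or 10.\<close>

lemma Re0_icosa: assumes "x \<in> icosa"
  shows "Re0 x \<in> {0, 1, -1, 1 / 2, - 1 / 2, tau / 2, - tau / 2, (tau - 1) / 2, (1 - tau) / 2}"
proof -
  obtain q w s where x: "x = q * w * s"
    and q: "q \<in> Q8" and w: "w \<in> omega_powers" and s: "s \<in> sigma_powers"
    using assms by (rule icosa_memE)
  show ?thesis
    unfolding x using q[unfolded Q8_eq] w[unfolded omega_powers_def] s[unfolded sigma_powers_def]
    by (elim insertE emptyE; hypsubst; simp add: Quat_mult field_simps)
qed

lemma square_eq_one: assumes "quat_norm_sq h = 1" "Re0 h = 1 \<or> Re0 h = - 1" shows "h * h = 1"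
proof -
  have "(Im1 h)\<^sup>2 + (Im2 h)\<^sup>2 + (Im3 h)\<^sup>2 = 0" using assms by (auto simp: quat_norm_sq_def)
  then have "Im1 h = 0" "Im2 h = 0" "Im3 h = 0" by (simp_all add: add_nonneg_eq_0_iff)
  then show ?thesis using assms(2) by (auto simp: quat_eq_iff)
qed

lemma square_eq_minus_one: assumes "quat_norm_sq h = 1" "Re0 h = 0" shows "h * h = - 1"
  using assms by (auto simp: quat_eq_iff quat_norm_sq_def power2_eq_square)

text \<open>The remaining elements have order 3 or 6, and \<open>h * h\<close> has order 3: both real parts are
  \<open>- 1 / 2\<close>.\<close>

lemma trace_tetra:
  assumes h: "h \<in> tetra" "h * h \<noteq> 1" "h * h \<noteq> - 1"
  shows "2 * (Re0 (h * h) + Re0 (h * h * (h * h))) \<le> - 2"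
proof -
  have N: "quat_norm_sq h = 1" using h(1) tetra_subset_icosa norm_icosa by auto
  then have "quat_norm_sq (h * h) = 1" by (simp add: quat_norm_sq_mult)
  note Re = Re0_square[OF this] Re0_square[OF N]
  have "Re0 h \<in> {1 / 2, - 1 / 2}"
    using Re0_tetra[OF h(1)] h(2,3) square_eq_one[OF N] square_eq_minus_one[OF N] by auto
  moreover have "r\<^sup>2 = 1 / 4" if "r \<in> {1 / 2, - 1 / 2}" for r :: real
    using that by (elim insertE emptyE; hypsubst; simp add: power2_eq_square)
  ultimately have sq: "(Re0 h)\<^sup>2 = 1 / 4" by blast
  show ?thesis unfolding Re sq by (simp add: power2_eq_square)
qed

text \<open>Here \<open>h * h\<close> has order 3 or 5.  In the latter case its real part and that of its square are
  \<open>(tau - 1) / 2\<close> and \<open>- tau / 2\<close> in some order, with sum \<open>- 1 / 2\<close>.\<close>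

lemma trace_icosa:
  assumes h: "h \<in> icosa" "h * h \<noteq> 1" "h * h \<noteq> - 1"
  shows "4 * (Re0 (h * h) + Re0 (h * h * (h * h))) \<le> - 2"
proof -
  have N: "quat_norm_sq h = 1" using h(1) norm_icosa by auto
  then have "quat_norm_sq (h * h) = 1" by (simp add: quat_norm_sq_mult)
  note Re = Re0_square[OF this] Re0_square[OF N]
  have "Re0 h \<in> {1 / 2, - 1 / 2, tau / 2, - tau / 2, (tau - 1) / 2, (1 - tau) / 2}"
    using Re0_icosa[OF h(1)] h(2,3) square_eq_one[OF N] square_eq_minus_one[OF N] by auto
  moreover have "r\<^sup>2 \<in> {1 / 4, (tau + 1) / 4, (2 - tau) / 4}"
    if "r \<in> {1 / 2, - 1 / 2, tau / 2, - tau / 2, (tau - 1) / 2, (1 - tau) / 2}" for r :: real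
    using that by (elim insertE emptyE; hypsubst; simp add: power2_eq_square field_simps tau_square)
  ultimately have "(Re0 h)\<^sup>2 \<in> {1 / 4, (tau + 1) / 4, (2 - tau) / 4}" by blast
  moreover have "4 * (2 * u - 1 + (2 * (2 * u - 1)\<^sup>2 - 1)) \<le> - 2"
    if "u \<in> {1 / 4, (tau + 1) / 4, (2 - tau) / 4}" for u
    using that by (elim insertE emptyE; hypsubst; simp add: power2_eq_square field_simps tau_square tau_tau_mult)
  ultimately show ?thesis unfolding Re by blast
qed

theorem proposition4p9:
  shows "min_perm_degree (binary_tetrahedral \<times>\<times> binary_tetrahedral) = 16 \<and>
         min_perm_degree (binary_icosahedral \<times>\<times> binary_icosahedral) = 48"
proof
  have mem: "- 1 \<in> tetra" "quat_i \<in> tetra"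
    by (rule tetra_memI[of "- 1" 1] tetra_memI[of quat_i 1]; simp add: Q8_def omega_powers_def Quat_one)+
  have tetra: "binary_tetrahedral = quat_units\<lparr>carrier := tetra\<rparr>"
    by (simp add: binary_tetrahedral_def)
  have icosa: "binary_icosahedral = quat_units\<lparr>carrier := icosa\<rparr>"
    by (simp add: binary_icosahedral_def)
  have "min_perm_degree (quat_units\<lparr>carrier := tetra\<rparr> \<times>\<times> quat_units\<lparr>carrier := tetra\<rparr>) = 2 * (card tetra div card omega_powers)"
  proof (rule quat_min_perm_degree_square[OF subgroup_tetra _ mem subgroup_omega_powers _ _ _ one_neq_zero])
    show "omega_powers \<subseteq> tetra"
      by (auto intro: tetra_memI[of 1] simp: Q8_def)
    show "finite tetra" using card_tetra by (intro card_ge_0_finite) simp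
    show "Im2 p = 1 * Im1 p" if "p \<in> omega_powers" for p
      using that by (auto simp: omega_powers_def)
    show "p = 1" if "p \<in> omega_powers" "Im1 p = 0" for p
      using that by (auto simp: omega_powers_def Quat_one)
    show "(real (card omega_powers) - 1) * (Re0 (h * h) + Re0 (h * h * (h * h))) \<le> - 2"
      if "h \<in> tetra" "h * h \<noteq> 1" "h * h \<noteq> - 1" for h
    proof -
      have "real (card omega_powers) - 1 = 2" by (simp add: card_omega_powers)
      then show ?thesis using trace_tetra[OF that] by (simp only:)
    qed
  qed (simp_all add: card_omega_powers)
  then show "min_perm_degree (binary_tetrahedral \<times>\<times> binary_tetrahedral) = 16"
    using tetra by (simp add: card_tetra card_omega_powers)
  have "min_perm_degree (quat_units\<lparr>carrier := icosa\<rparr> \<times>\<times> quat_units\<lparr>carrier := icosa\<rparr>) = 2 * (card icosa div card sigma_powers)"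
  proof (rule quat_min_perm_degree_square[OF subgroup_icosa _ _ _ subgroup_sigma_powers, where t = tau])
    show "sigma_powers \<subseteq> icosa"
      unfolding generate_sigma[symmetric] binary_icosahedral_def by (simp add: units.mono_generate)
    show "finite icosa" using card_icosa by (intro card_ge_0_finite) simp
    show "Im2 p = tau * Im1 p" if "p \<in> sigma_powers" for p
      using that by (auto simp: sigma_powers_def field_simps tau_square)
    show "p = 1" if "p \<in> sigma_powers" "Im1 p = 0" for p
      using that tau_gt by (auto simp: sigma_powers_def Quat_one)
    show "(real (card sigma_powers) - 1) * (Re0 (h * h) + Re0 (h * h * (h * h))) \<le> - 2"
      if "h \<in> icosa" "h * h \<noteq> 1" "h * h \<noteq> - 1" for h
    proof -
      have "real (card sigma_powers) - 1 = 4" by (simp add: card_sigma_powers)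
      then show ?thesis using trace_icosa[OF that] by (simp only:)
    qed
  qed (use mem tetra_subset_icosa tau_gt in \<open>auto simp: card_sigma_powers\<close>)
  then show "min_perm_degree (binary_icosahedral \<times>\<times> binary_icosahedral) = 48"
    using icosa by (simp add: card_icosa card_sigma_powers)
qed

end
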